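(* Let $M$ be a monoid such that the $\mathcal{J}$-class of the identity is a sofic group $G$. If any of the following conditions hold, then $M$ is sofic: (i) $G$ is amenable; (ii) $M \setminus G$ is finite; or (iii) every $\mathcal{R}$-class of $M$ outside the group of units is finite.
   Context: Sofic monoids: Let $M$ be a monoid with identity $1$. For a finite subset $K \subseteq M$ and $\epsilon > 0$, a (left) $(K,\epsilon)$-action of $M$ on a non-empty finite set $X$ is a map $M \times X \to X$, $(m,x) \mapsto m \cdot x$ (not required to be an action) such that: (1) $1 \cdot x = x$ for all $x \in X$; (2) for all $g,h \in K$, the proportion of elements $x \in X$ with $g \cdot (h \cdot x) = (gh)\cdot x$ is at least $1-\epsilon$; (3) for all $g,h \in K$ with $g \neq h$, the proportion of elements $x \in X$ with $g \cdot x = h \cdot x$ is at most $\epsilon$. The monoid $M$ is (left) sofic, or simply sofic, if for every finite $K \subseteq M$ and every $\epsilon > 0$ there exist a non-empty finite set $X$ and a $(K,\epsilon)$-action of $M$ on $X$. A sofic group is a group that is sofic in the usual sense; this is known to be equivalent to being sofic as a monoid, i.e. to the condition that for every finite subset $K$ of the group and every $\epsilon > 0$ there exist a non-empty finite set $X$ and a $(K,\epsilon)$-action of the group on $X$. Green's relations on $M$: $x \mathcal{J} y$ if and only if $MxM = MyM$; $x \mathcal{R} y$ if and only if $xM = yM$. If the $\mathcal{J}$-class of $1$ is a group $G$ (under the multiplication of $M$), then $G$ is the group of units of $M$. Amenability is that of discrete groups. *)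

theory Defs
  imports Complex_Main "HOL-Algebra.Coset" "HOL-Combinatorics.Permutations"
begin

section \<open>Sofic monoids\<close>

text \<open>
  The map \<open>act\<close> need not be an action; only its values for \<open>m \<in> carrier M\<close> and \<open>x \<in> X\<close> matter.
\<close>

definition approx_action ::
    "('a, 'b) monoid_scheme \<Rightarrow> 'a set \<Rightarrow> real \<Rightarrow> 'x set \<Rightarrow> ('a \<Rightarrow> 'x \<Rightarrow> 'x) \<Rightarrow> bool" where
  "approx_action M K \<epsilon> X act \<longleftrightarrow>
     finite X \<and> X \<noteq> {} \<and>
     (\<forall>m\<in>carrier M. \<forall>x\<in>X. act m x \<in> X) \<and>
     (\<forall>x\<in>X. act \<one>\<^bsub>M\<^esub> x = x) \<and>
     (\<forall>g\<in>K. \<forall>h\<in>K.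
        real (card {x \<in> X. act g (act h x) = act (g \<otimes>\<^bsub>M\<^esub> h) x}) / real (card X) \<ge> 1 - \<epsilon>) \<and>
     (\<forall>g\<in>K. \<forall>h\<in>K. g \<noteq> h \<longrightarrow>
        real (card {x \<in> X. act g x = act h x}) / real (card X) \<le> \<epsilon>)"

text \<open>
  Every finite set is in bijection with a set of natural numbers, so it is no loss of generality
  to let \<open>X\<close> range over the finite sets of natural numbers.
\<close>

definition sofic_monoid :: "('a, 'b) monoid_scheme \<Rightarrow> bool" where
  "sofic_monoid M \<longleftrightarrow> monoid M \<and>
     (\<forall>K \<epsilon>. finite K \<longrightarrow> K \<subseteq> carrier M \<longrightarrow> 0 < \<epsilon> \<longrightarrow>
        (\<exists>(X :: nat set) act. approx_action M K \<epsilon> X act))"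

section \<open>Sofic groups\<close>

definition hamming_dist :: "'x set \<Rightarrow> ('x \<Rightarrow> 'x) \<Rightarrow> ('x \<Rightarrow> 'x) \<Rightarrow> real" where
  "hamming_dist X p q = real (card {x \<in> X. p x \<noteq> q x}) / real (card X)"

text \<open>
  The usual notion, by almost-homomorphisms to finite symmetric groups. It agrees with soficity as
  a monoid; see \<open>sofic_group_iff_sofic_monoid\<close> below.
\<close>

definition sofic_group :: "('a, 'b) monoid_scheme \<Rightarrow> bool" where
  "sofic_group G \<longleftrightarrow> group G \<and>
     (\<forall>K \<epsilon>. finite K \<longrightarrow> K \<subseteq> carrier G \<longrightarrow> 0 < \<epsilon> \<longrightarrow>
        (\<exists>(X :: nat set) \<phi>. finite X \<and> X \<noteq> {} \<and>
           (\<forall>g\<in>carrier G. \<phi> g permutes X) \<and>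
           (\<forall>g\<in>K. \<forall>h\<in>K. hamming_dist X (\<phi> (g \<otimes>\<^bsub>G\<^esub> h)) (\<phi> g \<circ> \<phi> h) \<le> \<epsilon>) \<and>
           (\<forall>g\<in>K. \<forall>h\<in>K. g \<noteq> h \<longrightarrow> hamming_dist X (\<phi> g) (\<phi> h) \<ge> 1 - \<epsilon>)))"

section \<open>Amenable groups\<close>

text \<open>
  A discrete group is amenable if it carries a left-invariant finitely additive probability
  measure defined on all of its subsets.
\<close>

definition amenable_group :: "('a, 'b) monoid_scheme \<Rightarrow> bool" where
  "amenable_group G \<longleftrightarrow> group G \<and>
     (\<exists>\<mu> :: 'a set \<Rightarrow> real.
        (\<forall>A. A \<subseteq> carrier G \<longrightarrow> 0 \<le> \<mu> A) \<and>
        \<mu> (carrier G) = 1 \<and>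
        (\<forall>A B. A \<subseteq> carrier G \<longrightarrow> B \<subseteq> carrier G \<longrightarrow> A \<inter> B = {} \<longrightarrow> \<mu> (A \<union> B) = \<mu> A + \<mu> B) \<and>
        (\<forall>g\<in>carrier G. \<forall>A. A \<subseteq> carrier G \<longrightarrow> \<mu> (g <#\<^bsub>G\<^esub> A) = \<mu> A))"

section \<open>Green's relations\<close>

definition green_J :: "('a, 'b) monoid_scheme \<Rightarrow> 'a \<Rightarrow> 'a \<Rightarrow> bool" where
  "green_J M x y \<longleftrightarrow>
     (carrier M #>\<^bsub>M\<^esub> x) <#>\<^bsub>M\<^esub> carrier M = (carrier M #>\<^bsub>M\<^esub> y) <#>\<^bsub>M\<^esub> carrier M"

definition green_R :: "('a, 'b) monoid_scheme \<Rightarrow> 'a \<Rightarrow> 'a \<Rightarrow> bool" where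
  "green_R M x y \<longleftrightarrow> x <#\<^bsub>M\<^esub> carrier M = y <#\<^bsub>M\<^esub> carrier M"

definition J_class :: "('a, 'b) monoid_scheme \<Rightarrow> 'a \<Rightarrow> 'a set" where
  "J_class M x = {y \<in> carrier M. green_J M y x}"

definition R_class :: "('a, 'b) monoid_scheme \<Rightarrow> 'a \<Rightarrow> 'a set" where
  "R_class M x = {y \<in> carrier M. green_R M y x}"

section \<open>Soficity of groups agrees with soficity as monoids\<close>

lemma one_minus_le_iff: "0 < n \<Longrightarrow> 1 - e \<le> c / n \<longleftrightarrow> n - c \<le> e * n" for n e c :: real
  by (simp add: field_simps)

lemma card_sub_le:
  assumes "finite T" "S \<subseteq> T" "real (card T) \<le> e" shows "real (card S) \<le> e"
  using card_mono[OF assms(1,2)] assms(3) by linarith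

lemma card_Un_real: "real (card (A \<union> B)) \<le> real (card A) + real (card B)"
  using card_Un_le[of A B] by linarith

lemma card_compl_real:
  assumes "finite X"
  shows "real (card {x \<in> X. P x}) = real (card X) - real (card {x \<in> X. \<not> P x})"
proof -
  have "X = {x \<in> X. P x} \<union> {x \<in> X. \<not> P x}" by auto
  moreover have "card ({x \<in> X. P x} \<union> {x \<in> X. \<not> P x})
      = card {x \<in> X. P x} + card {x \<in> X. \<not> P x}"
    using assms by (intro card_Un_disjoint) auto
  ultimately show ?thesis by simp
qed

lemma extend_inj_to_permutes:
  assumes X: "finite X" and A: "A \<subseteq> X" and f: "inj_on f A" "f ` A \<subseteq> X"
  shows "\<exists>p. p permutes X \<and> (\<forall>x\<in>A. p x = f x)"
proof -
  have fin: "finite A" "finite (f ` A)" using X A f(2) by (auto intro: finite_subset)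
  have "card (X - A) = card (X - f ` A)"
    using fin A f by (simp add: card_Diff_subset card_image)
  then obtain h where h: "bij_betw h (X - A) (X - f ` A)"
    using finite_same_card_bij[of "X - A" "X - f ` A"] X by auto
  define p where "p x = (if x \<in> A then f x else if x \<in> X then h x else x)" for x
  have 1: "bij_betw p A (f ` A)"
    using f(1) by (auto simp: bij_betw_def p_def inj_on_def)
  have 2: "bij_betw p (X - A) (X - f ` A)"
    using h by (rule bij_betw_cong[THEN iffD1, rotated]) (auto simp: p_def)
  have "bij_betw p (A \<union> (X - A)) (f ` A \<union> (X - f ` A))"
    by (rule bij_betw_combine[OF 1 2]) auto
  moreover have "A \<union> (X - A) = X" "f ` A \<union> (X - f ` A) = X" using A f(2) by auto
  ultimately have "bij_betw p X X" by simp
  then have "p permutes X" by (rule bij_imp_permutes) (use A in \<open>auto simp: p_def\<close>)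
  then show ?thesis by (auto simp: p_def)
qed

lemma approx_actionI:
  fixes \<epsilon> :: real
  assumes "finite X" "X \<noteq> {}"
    and "\<And>m x. m \<in> carrier M \<Longrightarrow> x \<in> X \<Longrightarrow> act m x \<in> X"
    and "\<And>x. x \<in> X \<Longrightarrow> act \<one>\<^bsub>M\<^esub> x = x"
    and "\<And>g h. g \<in> K \<Longrightarrow> h \<in> K \<Longrightarrow>
      real (card {x \<in> X. act g (act h x) \<noteq> act (g \<otimes>\<^bsub>M\<^esub> h) x}) \<le> \<epsilon> * real (card X)"
    and "\<And>g h. g \<in> K \<Longrightarrow> h \<in> K \<Longrightarrow> g \<noteq> h \<Longrightarrow>
      real (card {x \<in> X. act g x = act h x}) \<le> \<epsilon> * real (card X)"
  shows "approx_action M K \<epsilon> X act"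
proof -
  have n: "0 < real (card X)" using assms(1,2) by (simp add: card_gt_0_iff)
  have "1 - \<epsilon> \<le> real (card {x \<in> X. act g (act h x) = act (g \<otimes>\<^bsub>M\<^esub> h) x}) / real (card X)"
    if "g \<in> K" "h \<in> K" for g h
    using assms(5)[OF that] n
      card_compl_real[OF assms(1), of "\<lambda>x. act g (act h x) = act (g \<otimes>\<^bsub>M\<^esub> h) x"]
    by (simp add: one_minus_le_iff)
  then show ?thesis
    using assms n by (simp add: approx_action_def pos_divide_le_eq)
qed

lemma approx_actionD:
  fixes \<epsilon> :: real
  assumes "approx_action M K \<epsilon> X act"
  shows "finite X" "0 < real (card X)"
    and "\<And>m x. m \<in> carrier M \<Longrightarrow> x \<in> X \<Longrightarrow> act m x \<in> X"
    and "\<And>x. x \<in> X \<Longrightarrow> act \<one>\<^bsub>M\<^esub> x = x"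
    and "\<And>g h. g \<in> K \<Longrightarrow> h \<in> K \<Longrightarrow>
      real (card {x \<in> X. act g (act h x) \<noteq> act (g \<otimes>\<^bsub>M\<^esub> h) x}) \<le> \<epsilon> * real (card X)"
    and "\<And>g h. g \<in> K \<Longrightarrow> h \<in> K \<Longrightarrow> g \<noteq> h \<Longrightarrow>
      real (card {x \<in> X. act g x = act h x}) \<le> \<epsilon> * real (card X)"
proof -
  show X: "finite X" and n: "0 < real (card X)"
    using assms by (auto simp: approx_action_def card_gt_0_iff)
  show "act m x \<in> X" if "m \<in> carrier M" "x \<in> X" for m x
    using assms that by (simp add: approx_action_def)
  show "act \<one>\<^bsub>M\<^esub> x = x" if "x \<in> X" for x
    using assms that by (simp add: approx_action_def)
  show "real (card {x \<in> X. act g x = act h x}) \<le> \<epsilon> * real (card X)"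
    if "g \<in> K" "h \<in> K" "g \<noteq> h" for g h
    using assms that n by (simp add: approx_action_def pos_divide_le_eq)
  show "real (card {x \<in> X. act g (act h x) \<noteq> act (g \<otimes>\<^bsub>M\<^esub> h) x}) \<le> \<epsilon> * real (card X)"
    if "g \<in> K" "h \<in> K" for g h
  proof -
    have "1 - \<epsilon> \<le> real (card {x \<in> X. act g (act h x) = act (g \<otimes>\<^bsub>M\<^esub> h) x}) / real (card X)"
      using assms that by (simp add: approx_action_def)
    then show ?thesis
      using n card_compl_real[OF X, of "\<lambda>x. act g (act h x) = act (g \<otimes>\<^bsub>M\<^esub> h) x"]
      by (simp add: one_minus_le_iff)
  qed
qed

lemma sofic_group_imp_sofic_monoid:
  assumes "sofic_group G" shows "sofic_monoid G"
proof -
  interpret group G using assms by (simp add: sofic_group_def)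
  have "\<exists>(X :: nat set) act. approx_action G K \<epsilon> X act"
    if K: "finite K" "K \<subseteq> carrier G" and e: "0 < \<epsilon>" for K \<epsilon>
  proof -
    have "finite (insert \<one>\<^bsub>G\<^esub> K)" "insert \<one>\<^bsub>G\<^esub> K \<subseteq> carrier G" "0 < \<epsilon> / 2"
      using K e by auto
    note ex = conjunct2[OF assms[unfolded sofic_group_def], THEN spec, THEN spec,
        THEN mp, THEN mp, THEN mp, OF this]
    obtain X :: "nat set" and \<phi> where X: "finite X" "X \<noteq> {}"
      and perm0: "\<forall>g\<in>carrier G. \<phi> g permutes X"
      and hom0: "\<forall>g\<in>insert \<one>\<^bsub>G\<^esub> K. \<forall>h\<in>insert \<one>\<^bsub>G\<^esub> K.
        hamming_dist X (\<phi> (g \<otimes>\<^bsub>G\<^esub> h)) (\<phi> g \<circ> \<phi> h) \<le> \<epsilon> / 2"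
      and free0: "\<forall>g\<in>insert \<one>\<^bsub>G\<^esub> K. \<forall>h\<in>insert \<one>\<^bsub>G\<^esub> K. g \<noteq> h \<longrightarrow>
        hamming_dist X (\<phi> g) (\<phi> h) \<ge> 1 - \<epsilon> / 2"
      using ex by (elim exE conjE) (rule that)
    note perm = perm0[rule_format] and hom = hom0[rule_format] and free = free0[rule_format]
    have n: "0 < real (card X)" using X by (simp add: card_gt_0_iff)
    define act where "act g = (if g = \<one>\<^bsub>G\<^esub> then id else \<phi> g)" for g
    define B where "B = {x \<in> X. \<phi> \<one>\<^bsub>G\<^esub> x \<noteq> x}"
    have hom': "real (card {x \<in> X. \<phi> (g \<otimes>\<^bsub>G\<^esub> h) x \<noteq> \<phi> g (\<phi> h x)}) \<le> \<epsilon> / 2 * real (card X)"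
      if "g \<in> insert \<one>\<^bsub>G\<^esub> K" "h \<in> insert \<one>\<^bsub>G\<^esub> K" for g h
      using hom[OF that] n by (simp add: hamming_dist_def pos_divide_le_eq mult.commute)
    have free': "real (card {x \<in> X. \<phi> g x = \<phi> h x}) \<le> \<epsilon> / 2 * real (card X)"
      if "g \<in> insert \<one>\<^bsub>G\<^esub> K" "h \<in> insert \<one>\<^bsub>G\<^esub> K" "g \<noteq> h" for g h
      using free[OF that] n card_compl_real[OF X(1), of "\<lambda>x. \<phi> g x = \<phi> h x"]
      by (simp add: hamming_dist_def one_minus_le_iff)
    have inj1: "inj (\<phi> \<one>\<^bsub>G\<^esub>)" using perm[OF one_closed] by (rule permutes_inj)
    have "\<phi> (\<one>\<^bsub>G\<^esub> \<otimes>\<^bsub>G\<^esub> \<one>\<^bsub>G\<^esub>) x \<noteq> \<phi> \<one>\<^bsub>G\<^esub> (\<phi> \<one>\<^bsub>G\<^esub> x) \<longleftrightarrow> \<phi> \<one>\<^bsub>G\<^esub> x \<noteq> x" for x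
      using inj_eq[OF inj1, of x "\<phi> \<one>\<^bsub>G\<^esub> x"] l_one[OF one_closed] by metis
    then have B1: "real (card B) \<le> \<epsilon> / 2 * real (card X)"
      using hom'[OF insertI1 insertI1] unfolding B_def by presburger
    have "finite B" unfolding B_def using X(1) by simp
    note B = B1 this
    have "approx_action G K \<epsilon> X act"
    proof (rule approx_actionI[OF X])
      show "act m x \<in> X" if "m \<in> carrier G" "x \<in> X" for m x
        using that perm[OF that(1)] by (auto simp: act_def permutes_in_image)
      show "act \<one>\<^bsub>G\<^esub> x = x" for x by (simp add: act_def)
    next
      fix g h assume gh: "g \<in> K" "h \<in> K"
      let ?T = "{x \<in> X. \<phi> (g \<otimes>\<^bsub>G\<^esub> h) x \<noteq> \<phi> g (\<phi> h x)}"
      have c: "g \<in> carrier G" "h \<in> carrier G" using gh K by auto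
      have sub: "{x \<in> X. act g (act h x) \<noteq> act (g \<otimes>\<^bsub>G\<^esub> h) x} \<subseteq> ?T \<union> B"
        using c by (auto simp: act_def B_def split: if_splits)
      have fin: "finite (?T \<union> B)" using X(1) B(2) by simp
      have le: "real (card (?T \<union> B)) \<le> \<epsilon> * real (card X)"
        using card_Un_real[of ?T B] hom'[of g h] gh B by (simp add: algebra_simps)
      show "real (card {x \<in> X. act g (act h x) \<noteq> act (g \<otimes>\<^bsub>G\<^esub> h) x}) \<le> \<epsilon> * real (card X)"
        by (rule card_sub_le[OF fin sub le])
    next
      fix g h assume gh: "g \<in> K" "h \<in> K" "g \<noteq> h"
      let ?T = "{x \<in> X. \<phi> g x = \<phi> h x}"
      have sub: "{x \<in> X. act g x = act h x} \<subseteq> ?T \<union> B"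
        using gh by (auto simp: act_def B_def split: if_splits)
      have fin: "finite (?T \<union> B)" using X(1) B(2) by simp
      have le: "real (card (?T \<union> B)) \<le> \<epsilon> * real (card X)"
        using card_Un_real[of ?T B] free'[of g h] gh B by (simp add: algebra_simps)
      show "real (card {x \<in> X. act g x = act h x}) \<le> \<epsilon> * real (card X)"
        by (rule card_sub_le[OF fin sub le])
    qed
    then show ?thesis by blast
  qed
  then show ?thesis by (simp add: sofic_monoid_def monoid_axioms)
qed

lemma sofic_monoid_imp_sofic_group:
  assumes "group G" "sofic_monoid G" shows "sofic_group G"
proof -
  interpret group G by fact
  have "\<exists>(X :: nat set) \<phi>. finite X \<and> X \<noteq> {} \<and>
           (\<forall>g\<in>carrier G. \<phi> g permutes X) \<and>
           (\<forall>g\<in>K. \<forall>h\<in>K. hamming_dist X (\<phi> (g \<otimes>\<^bsub>G\<^esub> h)) (\<phi> g \<circ> \<phi> h) \<le> \<epsilon>) \<and>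
           (\<forall>g\<in>K. \<forall>h\<in>K. g \<noteq> h \<longrightarrow> hamming_dist X (\<phi> g) (\<phi> h) \<ge> 1 - \<epsilon>)"
    if K: "finite K" "K \<subseteq> carrier G" and e: "0 < \<epsilon>" for K \<epsilon>
  proof -
    define L0 where "L0 = K \<union> (\<lambda>(g, h). g \<otimes>\<^bsub>G\<^esub> h) ` (K \<times> K)"
    define L where "L = L0 \<union> m_inv G ` L0"
    have L0: "finite L0" "L0 \<subseteq> carrier G" using K by (auto simp: L0_def)
    then have L: "finite L" "L \<subseteq> carrier G" by (auto simp: L_def)
    have "\<exists>(X :: nat set) act. approx_action G L (\<epsilon> / 4) X act"
      using assms(2) L e by (simp add: sofic_monoid_def)
    then obtain X :: "nat set" and act where act: "approx_action G L (\<epsilon> / 4) X act" by blast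
    note D = approx_actionD[OF act]
    define n where "n = real (card X)"
    define A where "A g = {x \<in> X. act (inv\<^bsub>G\<^esub> g) (act g x) = x}" for g
    have A_sub: "A g \<subseteq> X" for g by (auto simp: A_def)
    have A_card: "real (card (X - A g)) \<le> \<epsilon> / 4 * n" if "g \<in> L0" for g
    proof -
      have g: "g \<in> carrier G" "g \<in> L" "inv\<^bsub>G\<^esub> g \<in> L" using that L0 by (auto simp: L_def)
      have "X - A g = {x \<in> X. act (inv\<^bsub>G\<^esub> g) (act g x) \<noteq> act (inv\<^bsub>G\<^esub> g \<otimes>\<^bsub>G\<^esub> g) x}"
        using g D(4) by (auto simp: A_def)
      then show ?thesis using D(5)[OF g(3,2)] by (simp add: n_def)
    qed
    have inj: "inj_on (act g) (A g)" for g
      by (rule inj_on_inverseI[of _ "act (inv\<^bsub>G\<^esub> g)"]) (auto simp: A_def)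
    have "\<exists>p. p permutes X \<and> (\<forall>x\<in>A g. p x = act g x)" if "g \<in> carrier G" for g
      using D(3)[OF that] A_sub[of g] by (intro extend_inj_to_permutes[OF D(1) A_sub inj]) auto
    then obtain p where p: "\<And>g. g \<in> carrier G \<Longrightarrow> p g permutes X"
      "\<And>g x. g \<in> carrier G \<Longrightarrow> x \<in> A g \<Longrightarrow> p g x = act g x"
      by metis
    have hom: "hamming_dist X (p (g \<otimes>\<^bsub>G\<^esub> h)) (p g \<circ> p h) \<le> \<epsilon>" if gh: "g \<in> K" "h \<in> K" for g h
    proof -
      have c: "g \<in> carrier G" "h \<in> carrier G" "g \<in> L0" "h \<in> L0" "g \<otimes>\<^bsub>G\<^esub> h \<in> L0" "g \<in> L" "h \<in> L"
        using gh K by (auto simp: L0_def L_def)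
      let ?T1 = "X - A (g \<otimes>\<^bsub>G\<^esub> h)" and ?T2 = "X - A h" and ?T3 = "{x \<in> A h. act h x \<notin> A g}"
        and ?T4 = "{x \<in> X. act g (act h x) \<noteq> act (g \<otimes>\<^bsub>G\<^esub> h) x}"
      have T3: "real (card ?T3) \<le> \<epsilon> / 4 * n"
      proof -
        have "card ?T3 = card (act h ` ?T3)"
          by (rule card_image[symmetric]) (rule inj_on_subset[OF inj], auto)
        also have "\<dots> \<le> card (X - A g)"
          using D(1) D(3)[OF c(2)] A_sub[of h] by (intro card_mono) auto
        finally show ?thesis using A_card[OF c(3)] by linarith
      qed
      have "p (g \<otimes>\<^bsub>G\<^esub> h) x = p g (p h x)"
        if "x \<in> X" "x \<notin> ?T1" "x \<notin> ?T2" "x \<notin> ?T3" "x \<notin> ?T4" for x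
        using that p(2)[of h x] p(2)[of g "act h x"] p(2)[of "g \<otimes>\<^bsub>G\<^esub> h" x] c by auto
      then have sub: "{x \<in> X. p (g \<otimes>\<^bsub>G\<^esub> h) x \<noteq> (p g \<circ> p h) x} \<subseteq> ?T1 \<union> (?T2 \<union> (?T3 \<union> ?T4))"
        unfolding o_def by blast
      have fin: "finite (?T1 \<union> (?T2 \<union> (?T3 \<union> ?T4)))"
        using D(1) A_sub[of h] by (auto intro: finite_subset[of _ X])
      have "real (card (?T1 \<union> (?T2 \<union> (?T3 \<union> ?T4)))) \<le> \<epsilon> * n"
        using card_Un_real[of ?T1 "?T2 \<union> (?T3 \<union> ?T4)"] card_Un_real[of ?T2 "?T3 \<union> ?T4"]
          card_Un_real[of ?T3 ?T4] A_card[OF c(5)] A_card[OF c(4)] T3 D(5)[OF c(6,7)]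
        by (simp add: n_def)
      from card_sub_le[OF fin sub this] show ?thesis
        using D(2) by (simp add: hamming_dist_def pos_divide_le_eq n_def)
    qed
    have free: "hamming_dist X (p g) (p h) \<ge> 1 - \<epsilon>" if gh: "g \<in> K" "h \<in> K" "g \<noteq> h" for g h
    proof -
      have c: "g \<in> carrier G" "h \<in> carrier G" "g \<in> L0" "h \<in> L0" "g \<in> L" "h \<in> L"
        using gh K by (auto simp: L0_def L_def)
      let ?T1 = "X - A g" and ?T2 = "X - A h" and ?T3 = "{x \<in> X. act g x = act h x}"
      have sub: "{x \<in> X. p g x = p h x} \<subseteq> ?T1 \<union> (?T2 \<union> ?T3)"
        using p(2) c by auto
      have fin: "finite (?T1 \<union> (?T2 \<union> ?T3))" using D(1) by auto
      have "0 \<le> \<epsilon> / 4 * n" using e by (simp add: n_def)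
      then have "real (card (?T1 \<union> (?T2 \<union> ?T3))) \<le> \<epsilon> * n"
        using card_Un_real[of ?T1 "?T2 \<union> ?T3"] card_Un_real[of ?T2 ?T3]
          A_card[OF c(3)] A_card[OF c(4)] D(6)[OF c(5,6) gh(3)]
        by (simp add: n_def)
      from card_sub_le[OF fin sub this] show ?thesis
        using D(2) card_compl_real[OF D(1), of "\<lambda>x. p g x = p h x"]
        by (simp add: hamming_dist_def one_minus_le_iff n_def)
    qed
    have "X \<noteq> {}" using D(2) by auto
    then show ?thesis
      by (intro exI[of _ X] exI[of _ p] conjI ballI impI D(1) p(1) hom free)
  qed
  then show ?thesis by (simp add: sofic_group_def group_axioms)
qed

theorem sofic_group_iff_sofic_monoid:
  assumes "group G" shows "sofic_group G \<longleftrightarrow> sofic_monoid G"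
  using assms sofic_group_imp_sofic_monoid sofic_monoid_imp_sofic_group by blast

end

theory Submission
  imports Defs
begin

text \<open>
  Let \<open>G\<close> be the \<open>\<J>\<close>-class of the identity of \<open>M\<close>. Since \<open>G\<close> is a group, it is the group of units
  and its complement is an ideal: a factor of a unit lies in the \<open>\<J>\<close>-class of the identity. An
  approximate action of \<open>G\<close> on a finite set \<open>X\<close> is extended to \<open>M\<close> by letting a non-unit \<open>m\<close> throw
  every point of \<open>X\<close> into a finite subset \<open>Y\<close> of \<open>M\<close>, on which \<open>M\<close> acts by left multiplication as
  far as \<open>Y\<close> permits. After replacing \<open>X\<close> by many copies of itself, \<open>Y\<close> is a negligible part of the
  whole, so only what happens at points of \<open>X\<close> matters.

  The point \<open>x\<close> is thrown to \<open>m \<otimes> \<phi> x\<close>, where \<open>\<phi>\<close> maps \<open>X\<close> to \<open>G\<close>. Different non-units then move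
  \<open>x\<close> to different points because \<open>\<phi> x\<close> is invertible, and \<open>g \<sqdot> (m \<sqdot> x) = (g \<otimes> m) \<sqdot> x\<close> is associativity.
  The one remaining condition, for a non-unit \<open>m\<close> and a unit \<open>h\<close>, is
  \<open>m \<otimes> \<phi> (h \<sqdot> x) = m \<otimes> h \<otimes> \<phi> x\<close> for most \<open>x\<close>: up to what the non-units in question cannot see,
  \<open>\<phi>\<close> has to be almost equivariant. Lemma \<open>approx_action_extend\<close> carries this out.

  If \<open>G\<close> is amenable, a Folner set \<open>X \<subseteq> G\<close> with the inclusion as \<open>\<phi>\<close> does it. If the orbits \<open>mG\<close> of
  the non-units are finite, then \<open>G\<close> acts by right multiplication on a finite union of them through
  a finite set \<open>P\<close> of permutations; there \<open>X\<close> is the product of a sofic approximation of \<open>G\<close> with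
  \<open>P\<close>, and \<open>\<phi>\<close> chooses a unit inducing the given permutation. Finiteness of the orbits follows both
  from finiteness of \<open>M - G\<close>, which contains them, and from finiteness of the \<open>\<R>\<close>-classes outside
  \<open>G\<close>, because \<open>mG\<close> lies in the \<open>\<R>\<close>-class of \<open>m\<close>.

  Folner sets are obtained from an invariant mean by the combinatorial route. If there were none,
  some finite \<open>T \<subseteq> G\<close> would satisfy \<open>|TF| \<ge> 2|F|\<close> for all finite \<open>F\<close>, and Hall's theorem for
  infinite families of finite sets would produce an injection \<open>a : G \<times> {0,1} \<rightarrow> G\<close> with
  \<open>a (g, b) \<in> Tg\<close>. Cutting \<open>G\<close> into the pieces on which \<open>a (-, b)\<close> is multiplication by a fixed
  element of \<open>T\<close> gives a paradoxical decomposition: two copies of \<open>G\<close> are moved, piece by piece, to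
  disjoint parts of \<open>G\<close>, so an invariant mean would assign to \<open>G\<close> a mass of at least \<open>2\<close>.
\<close>

section \<open>Systems of distinct representatives\<close>

text \<open>
  Rado's argument. Regard \<open>A\<close> as the relation \<open>E\<close> of the pairs \<open>(i, x)\<close> with \<open>x \<in> A i\<close>. By Zorn's
  lemma there is a minimal subrelation \<open>R\<close> that still satisfies Hall's condition, and such an \<open>R\<close> is
  single-valued. Indeed, were \<open>x\<close> and \<open>y\<close> two values at \<open>i\<close>, then by minimality removing either one
  would make the condition fail at some sets \<open>insert i P\<close> and \<open>insert i Q\<close>; but the union of the two
  reduced images is the full image of \<open>insert i (P \<union> Q)\<close>, and their intersection contains the image
  of \<open>P \<inter> Q\<close>, so inclusion and exclusion contradict Hall's condition for \<open>R\<close>.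
\<close>

lemma infinite_hall:
  fixes A :: "'i \<Rightarrow> 'b set"
  assumes fin: "\<And>i. i \<in> I \<Longrightarrow> finite (A i)"
    and hall: "\<And>J. finite J \<Longrightarrow> J \<subseteq> I \<Longrightarrow> card J \<le> card (\<Union> (A ` J))"
  obtains f where "inj_on f I" "\<And>i. i \<in> I \<Longrightarrow> f i \<in> A i"
proof -
  define E where "E = Sigma I A"
  define H where "H R \<longleftrightarrow> (\<forall>J. finite J \<longrightarrow> J \<subseteq> I \<longrightarrow> card J \<le> card (R `` J))"
    for R :: "('i \<times> 'b) set"
  have finE: "finite (R `` J)" if "R \<subseteq> E" "finite J" for R J
  proof -
    have "R `` J \<subseteq> \<Union> (A ` (J \<inter> I))" using that by (auto simp: E_def)
    moreover have "finite (\<Union> (A ` (J \<inter> I)))" using that fin by auto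
    ultimately show ?thesis by (rule finite_subset)
  qed
  \<comment> \<open>Zorn's lemma yields maximal elements, so it is applied to the set \<open>D\<close> of removed pairs. Hall's
    condition survives the union of a chain because at a finite \<open>J\<close> only the finite part of \<open>E\<close> over
    \<open>J\<close> matters, and what the union removes from it is removed by one member already.\<close>
  have chain: "\<exists>U\<in>{D. H (E - D)}. \<forall>D\<in>C. D \<subseteq> U" if C: "subset.chain {D. H (E - D)} C" for C
  proof (intro bexI[of _ "\<Union>C"] ballI)
    have "card J \<le> card ((E - \<Union>C) `` J)" if J: "finite J" "J \<subseteq> I" for J
    proof (cases "C = {}")
      case True
      have "E `` J = \<Union> (A ` J)" using J by (auto simp: E_def)
      then show ?thesis using True hall[OF J] by simp
    next
      case False
      let ?Q = "Sigma J A \<inter> \<Union>C"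
      have "finite ?Q" using J fin by auto
      then obtain D where D: "D \<in> C" "?Q \<subseteq> D"
        using finite_subset_Union_chain[of ?Q C] False C by (metis Int_lower2)
      have "H (E - D)" using C D(1) by (auto simp: subset_chain_def)
      then have "card J \<le> card ((E - D) `` J)" using J by (simp add: H_def)
      also have "(E - D) `` J = (E - \<Union>C) `` J"
        using D J by (auto simp: E_def Image_iff)
      finally show ?thesis .
    qed
    then show "\<Union>C \<in> {D. H (E - D)}" by (simp add: H_def)
  qed auto
  obtain D where D: "H (E - D)" "\<And>D'. H (E - D') \<Longrightarrow> D \<subseteq> D' \<Longrightarrow> D' = D"
    using subset_Zorn[OF chain] by auto
  define R where "R = E - D"
  have RE: "R \<subseteq> E" by (auto simp: R_def)
  have HR: "card J \<le> card (R `` J)" if "finite J" "J \<subseteq> I" for J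
    using D(1) that by (simp add: R_def H_def)
  have critical: "\<exists>P. finite P \<and> P \<subseteq> I \<and> i \<notin> P \<and> card (R `` P \<union> (R `` {i} - {x})) \<le> card P"
    if ix: "(i, x) \<in> R" for i x
  proof -
    have "insert (i, x) D \<noteq> D" using ix by (auto simp: R_def)
    then have "\<not> H (E - insert (i, x) D)" using D(2) by blast
    moreover have "E - insert (i, x) D = R - {(i, x)}" by (auto simp: R_def)
    ultimately obtain J where J: "finite J" "J \<subseteq> I" "card ((R - {(i, x)}) `` J) < card J"
      by (auto simp: H_def not_le)
    have iJ: "i \<in> J"
    proof (rule ccontr)
      assume "i \<notin> J"
      then have "(R - {(i, x)}) `` J = R `` J" by auto
      then show False using HR[OF J(1,2)] J(3) by simp
    qed
    have "R `` (J - {i}) \<union> (R `` {i} - {x}) \<subseteq> (R - {(i, x)}) `` J"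
      using iJ by auto
    moreover have "finite ((R - {(i, x)}) `` J)" using RE J(1) by (intro finE) auto
    ultimately have "card (R `` (J - {i}) \<union> (R `` {i} - {x})) \<le> card ((R - {(i, x)}) `` J)"
      by (rule card_mono[rotated])
    also have "\<dots> \<le> card (J - {i})" using J iJ by simp
    finally show ?thesis using J by (intro exI[of _ "J - {i}"]) auto
  qed
  have single: "x = y" if xy: "(i, x) \<in> R" "(i, y) \<in> R" for i x y
  proof (rule ccontr)
    assume "x \<noteq> y"
    obtain P where P: "finite P" "P \<subseteq> I" "i \<notin> P" "card (R `` P \<union> (R `` {i} - {x})) \<le> card P"
      using critical[OF xy(1)] by blast
    obtain Q where Q: "finite Q" "Q \<subseteq> I" "i \<notin> Q" "card (R `` Q \<union> (R `` {i} - {y})) \<le> card Q"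
      using critical[OF xy(2)] by blast
    let ?X = "R `` P \<union> (R `` {i} - {x})" and ?Y = "R `` Q \<union> (R `` {i} - {y})"
    have fin: "finite ?X" "finite ?Y" using RE P(1) Q(1) by (auto intro!: finE)
    have i: "i \<in> I" using xy RE by (auto simp: E_def)
    have "card (insert i (P \<union> Q)) \<le> card (R `` insert i (P \<union> Q))"
      using P Q i by (intro HR) auto
    also have "R `` insert i (P \<union> Q) = ?X \<union> ?Y" using \<open>x \<noteq> y\<close> by auto
    finally have union: "card (P \<union> Q) + 1 \<le> card (?X \<union> ?Y)" using P Q by simp
    have "card (P \<inter> Q) \<le> card (R `` (P \<inter> Q))" using P Q by (intro HR) auto
    also have "\<dots> \<le> card (?X \<inter> ?Y)" using fin by (intro card_mono) auto
    finally have inter: "card (P \<inter> Q) \<le> card (?X \<inter> ?Y)" .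
    show False
      using union inter P(4) Q(4) card_Un_Int[OF P(1) Q(1)] card_Un_Int[OF fin] by linarith
  qed
  have "\<exists>x. (i, x) \<in> R" if "i \<in> I" for i
  proof -
    have "card {i} \<le> card (R `` {i})" using that by (intro HR) auto
    then have "R `` {i} \<noteq> {}" by auto
    then show ?thesis by blast
  qed
  then obtain f where f: "\<And>i. i \<in> I \<Longrightarrow> (i, f i) \<in> R" by metis
  have "inj_on f I"
  proof (rule inj_onI, rule ccontr)
    fix i j assume ij: "i \<in> I" "j \<in> I" "f i = f j" "i \<noteq> j"
    have "R `` {i, j} \<subseteq> {f i}" using f[OF ij(1)] f[OF ij(2)] single ij(3) by auto
    then have "card (R `` {i, j}) \<le> 1" using card_mono[of "{f i}"] by fastforce
    moreover have "card {i, j} \<le> card (R `` {i, j})" using ij by (intro HR) auto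
    ultimately show False using ij(4) by simp
  qed
  then show thesis using that f RE by (auto simp: E_def)
qed

section \<open>Folner sets\<close>

lemma (in group) iterated_expansion:
  assumes S: "finite S" "S \<subseteq> carrier G" and d: "0 < \<delta>"
    and exp: "\<And>F. finite F \<Longrightarrow> F \<subseteq> carrier G \<Longrightarrow> (1 + \<delta>) * real (card F) \<le> real (card (S <#> F))"
  shows "\<exists>T. finite T \<and> T \<subseteq> carrier G \<and>
    (\<forall>F. finite F \<longrightarrow> F \<subseteq> carrier G \<longrightarrow> (1 + \<delta>) ^ n * real (card F) \<le> real (card (T <#> F)))"
proof (induction n)
  case 0
  have "{\<one>} <#> F = F" if "F \<subseteq> carrier G" for F
    using that by (force simp: set_mult_def)
  then show ?case by (intro exI[of _ "{\<one>}"]) auto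
next
  case (Suc n)
  then obtain T where T: "finite T" "T \<subseteq> carrier G"
    "\<And>F. finite F \<Longrightarrow> F \<subseteq> carrier G \<Longrightarrow> (1 + \<delta>) ^ n * real (card F) \<le> real (card (T <#> F))"
    by blast
  have fin: "finite (A <#> B)" if "finite A" "finite B" for A B :: "'a set"
    using that by (auto simp: set_mult_def)
  have "(1 + \<delta>) ^ Suc n * real (card F) \<le> real (card ((S <#> T) <#> F))"
    if F: "finite F" "F \<subseteq> carrier G" for F
  proof -
    have "(1 + \<delta>) ^ Suc n * real (card F) = (1 + \<delta>) * ((1 + \<delta>) ^ n * real (card F))" by simp
    also have "\<dots> \<le> (1 + \<delta>) * real (card (T <#> F))"
      using T(3)[OF F] d by (intro mult_left_mono) auto
    also have "\<dots> \<le> real (card (S <#> (T <#> F)))"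
      using T F by (intro exp fin set_mult_closed)
    also have "S <#> (T <#> F) = (S <#> T) <#> F"
      using S T F by (simp add: set_mult_assoc)
    finally show ?thesis .
  qed
  then show ?case
    using S T fin set_mult_closed by (intro exI[of _ "S <#> T"]) auto
qed

lemma finitely_additive_sum:
  fixes \<mu> :: "'a set \<Rightarrow> real"
  assumes add: "\<And>A B. A \<subseteq> C \<Longrightarrow> B \<subseteq> C \<Longrightarrow> A \<inter> B = {} \<Longrightarrow> \<mu> (A \<union> B) = \<mu> A + \<mu> B"
    and "finite T" "\<And>t. t \<in> T \<Longrightarrow> B t \<subseteq> C" "disjoint_family_on B T"
  shows "\<mu> (\<Union>t\<in>T. B t) = (\<Sum>t\<in>T. \<mu> (B t))"
  using assms(2-)
proof (induction T)
  case empty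
  show ?case using add[of "{}" "{}"] by simp
next
  case (insert t T)
  have "B t \<inter> (\<Union>t\<in>T. B t) = {}"
    using insert.hyps(2) insert.prems(2) by (fastforce simp: disjoint_family_on_def)
  then have "\<mu> (B t \<union> (\<Union>t\<in>T. B t)) = \<mu> (B t) + \<mu> (\<Union>t\<in>T. B t)"
    using insert.prems(1) by (intro add) auto
  moreover have "disjoint_family_on B T"
    using insert.prems(2) by (auto simp: disjoint_family_on_def)
  ultimately show ?case using insert by simp
qed

text \<open>
  A doubling set \<open>T\<close> would make the group paradoxical. The index set of the family in Hall's theorem
  consists of the pairs of a group element and a Boolean, so that Hall's condition follows from
  the doubling inequality for the set of first components. The group element
  \<open>g\<close> belongs to the piece \<open>B (b, t)\<close> when \<open>a (g, b) = t \<otimes> g\<close>; for fixed \<open>b\<close> these pieces partition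
  the group, while all their translates \<open>B' (b, t)\<close> are disjoint.
\<close>

lemma amenable_group_not_doubling:
  assumes am: "amenable_group G" and T: "finite T" "T \<subseteq> carrier G"
  shows "\<exists>F. finite F \<and> F \<subseteq> carrier G \<and> card (T <#>\<^bsub>G\<^esub> F) < 2 * card F"
proof (rule ccontr)
  interpret group G using am by (simp add: amenable_group_def)
  assume "\<not> ?thesis"
  then have doubling: "2 * card F \<le> card (T <#>\<^bsub>G\<^esub> F)" if "finite F" "F \<subseteq> carrier G" for F
    using that by (meson not_le)
  obtain \<mu> :: "'a set \<Rightarrow> real" where
    pos0: "\<forall>A. A \<subseteq> carrier G \<longrightarrow> 0 \<le> \<mu> A"
    and one: "\<mu> (carrier G) = 1"
    and add0: "\<forall>A B. A \<subseteq> carrier G \<longrightarrow> B \<subseteq> carrier G \<longrightarrow> A \<inter> B = {} \<longrightarrow> \<mu> (A \<union> B) = \<mu> A + \<mu> B"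
    and inv0: "\<forall>g\<in>carrier G. \<forall>A. A \<subseteq> carrier G \<longrightarrow> \<mu> (g <#\<^bsub>G\<^esub> A) = \<mu> A"
    using am unfolding amenable_group_def by (elim exE conjE) (rule that)
  note pos = pos0[rule_format] and add = add0[rule_format] and inv = inv0[rule_format]
  define A where "A i = (\<lambda>t. t \<otimes>\<^bsub>G\<^esub> fst i) ` T" for i :: "'a \<times> bool"
  have hall: "card J \<le> card (\<Union> (A ` J))" if J: "finite J" "J \<subseteq> carrier G \<times> UNIV" for J
  proof -
    have "J \<subseteq> fst ` J \<times> (UNIV :: bool set)" by force
    then have "card J \<le> card (fst ` J \<times> (UNIV :: bool set))"
      using J by (intro card_mono) auto
    also have "\<dots> = 2 * card (fst ` J)" by (simp add: card_cartesian_product)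
    also have "\<dots> \<le> card (T <#>\<^bsub>G\<^esub> (fst ` J))" using J by (intro doubling) auto
    also have "T <#>\<^bsub>G\<^esub> (fst ` J) = \<Union> (A ` J)" by (auto simp: set_mult_def A_def)
    finally show ?thesis .
  qed
  \<comment> \<open>The map \<open>a\<close> embeds two copies of the group into one.\<close>
  obtain a where a: "inj_on a (carrier G \<times> UNIV)" "\<And>i. i \<in> carrier G \<times> UNIV \<Longrightarrow> a i \<in> A i"
  proof (rule infinite_hall[of "carrier G \<times> UNIV" A])
    show "finite (A i)" for i using T by (simp add: A_def)
  qed (use hall in auto)
  have "\<forall>i\<in>carrier G \<times> UNIV. \<exists>t\<in>T. a i = t \<otimes>\<^bsub>G\<^esub> fst i" using a(2) by (fastforce simp: A_def)
  then obtain \<tau> where \<tau>: "\<And>i. i \<in> carrier G \<times> UNIV \<Longrightarrow> \<tau> i \<in> T \<and> a i = \<tau> i \<otimes>\<^bsub>G\<^esub> fst i"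
    by metis
  define B where "B p = {g \<in> carrier G. \<tau> (g, fst p) = snd p}" for p :: "bool \<times> 'a"
  define B' where "B' p = snd p <#\<^bsub>G\<^esub> B p" for p :: "bool \<times> 'a"
  have B_sub: "B p \<subseteq> carrier G" for p by (auto simp: B_def)
  have B'_sub: "B' p \<subseteq> carrier G" if "p \<in> UNIV \<times> T" for p
    using that T by (auto simp: B'_def B_def l_coset_def)
  have B'_elim: "\<exists>g\<in>carrier G. y = a (g, fst p) \<and> snd p = \<tau> (g, fst p)" if "y \<in> B' p" for y p
  proof -
    obtain g where g: "g \<in> carrier G" "\<tau> (g, fst p) = snd p" "y = snd p \<otimes>\<^bsub>G\<^esub> g"
      using \<open>y \<in> B' p\<close> by (auto simp: B'_def l_coset_def B_def)
    then show ?thesis using \<tau>[of "(g, fst p)"] by (intro bexI[of _ g]) auto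
  qed
  have disj: "disjoint_family_on B' (UNIV \<times> T)"
    unfolding disjoint_family_on_def
  proof (intro ballI impI)
    fix p q :: "bool \<times> 'a" assume "p \<noteq> q"
    have False if y: "y \<in> B' p" "y \<in> B' q" for y
    proof -
      obtain g h where gh: "g \<in> carrier G" "h \<in> carrier G" "a (g, fst p) = a (h, fst q)"
        "snd p = \<tau> (g, fst p)" "snd q = \<tau> (h, fst q)"
        using B'_elim[OF y(1)] B'_elim[OF y(2)] by auto
      then have "(g, fst p) = (h, fst q)" by (intro inj_onD[OF a(1)]) auto
      then show False using gh \<open>p \<noteq> q\<close> by (simp add: prod_eq_iff)
    qed
    then show "B' p \<inter> B' q = {}" by blast
  qed
  have "2 = (\<Sum>b\<in>(UNIV :: bool set). \<mu> (carrier G))" by (simp add: one UNIV_bool)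
  also have "\<dots> = (\<Sum>b\<in>UNIV. \<Sum>t\<in>T. \<mu> (B (b, t)))"
  proof (rule sum.cong[OF refl])
    fix b :: bool
    have "carrier G = (\<Union>t\<in>T. B (b, t))" using \<tau> by (auto simp: B_def)
    then have "\<mu> (carrier G) = \<mu> (\<Union>t\<in>T. B (b, t))" by simp
    also have "\<dots> = (\<Sum>t\<in>T. \<mu> (B (b, t)))"
      by (rule finitely_additive_sum[OF add])
        (use T B_sub in \<open>auto simp: disjoint_family_on_def B_def\<close>)
    finally show "\<mu> (carrier G) = \<dots>" .
  qed
  also have "\<dots> = (\<Sum>p\<in>UNIV \<times> T. \<mu> (B p))" by (simp add: sum.cartesian_product)
  also have "\<dots> = (\<Sum>p\<in>UNIV \<times> T. \<mu> (B' p))"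
    using T B_sub inv by (intro sum.cong) (auto simp: B'_def subset_iff)
  also have "\<dots> = \<mu> (\<Union>p\<in>UNIV \<times> T. B' p)"
    by (rule finitely_additive_sum[OF add, symmetric]) (use T B'_sub disj in auto)
  also have "\<dots> \<le> \<mu> (carrier G)"
  proof -
    let ?V = "\<Union>p\<in>UNIV \<times> T. B' p"
    have V: "?V \<subseteq> carrier G" using B'_sub by blast
    then have "\<mu> (?V \<union> (carrier G - ?V)) = \<mu> ?V + \<mu> (carrier G - ?V)" by (intro add) auto
    moreover have "?V \<union> (carrier G - ?V) = carrier G" using V by auto
    ultimately show ?thesis using pos[of "carrier G - ?V"] by simp
  qed
  finally show False using one by simp
qed

text \<open>
  If \<open>S\<close> has no \<open>\<delta>\<close>-invariant finite set, then \<open>insert \<one> S\<close> enlarges every finite set by the factor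
  \<open>1 + \<delta>\<close>: besides \<open>F\<close> itself, \<open>SF\<close> contains the translate of a large part of \<open>F\<close> that leaves \<open>F\<close>.
  A sufficiently high power of \<open>insert \<one> S\<close> is then doubling.
\<close>

lemma amenable_group_Folner:
  fixes \<delta> :: real
  assumes am: "amenable_group G" and S: "finite S" "S \<subseteq> carrier G" and d: "0 < \<delta>"
  shows "\<exists>F. finite F \<and> F \<noteq> {} \<and> F \<subseteq> carrier G \<and>
    (\<forall>s\<in>S. real (card {f \<in> F. s \<otimes>\<^bsub>G\<^esub> f \<notin> F}) \<le> \<delta> * real (card F))"
proof (rule ccontr)
  interpret group G using am by (simp add: amenable_group_def)
  assume no: "\<not> ?thesis"
  let ?S = "insert \<one>\<^bsub>G\<^esub> S"
  have exp: "(1 + \<delta>) * real (card F) \<le> real (card (?S <#>\<^bsub>G\<^esub> F))"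
    if F: "finite F" "F \<subseteq> carrier G" for F
  proof (cases "F = {}")
    case False
    then obtain s where s: "s \<in> S" "\<delta> * real (card F) < real (card {f \<in> F. s \<otimes>\<^bsub>G\<^esub> f \<notin> F})"
      using no F by (meson not_le)
    let ?N = "{f \<in> F. s \<otimes>\<^bsub>G\<^esub> f \<notin> F}"
    have "inj_on (\<lambda>f. s \<otimes>\<^bsub>G\<^esub> f) ?N" using s F S by (auto simp: inj_on_def subset_iff Units_eq)
    then have "card F + card ?N = card F + card ((\<lambda>f. s \<otimes>\<^bsub>G\<^esub> f) ` ?N)" by (simp add: card_image)
    also have "\<dots> = card (F \<union> (\<lambda>f. s \<otimes>\<^bsub>G\<^esub> f) ` ?N)"
      using F by (intro card_Un_disjoint[symmetric]) auto
    also have "\<dots> \<le> card (?S <#>\<^bsub>G\<^esub> F)"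
    proof (rule card_mono)
      show "finite (?S <#>\<^bsub>G\<^esub> F)" using S F by (auto simp: set_mult_def)
      have "f \<in> ?S <#>\<^bsub>G\<^esub> F" if "f \<in> F" for f
        using that F(2) l_one[of f] unfolding set_mult_def by force
      moreover have "s \<otimes>\<^bsub>G\<^esub> f \<in> ?S <#>\<^bsub>G\<^esub> F" if "f \<in> F" for f
        using that s(1) unfolding set_mult_def by force
      ultimately show "F \<union> (\<lambda>f. s \<otimes>\<^bsub>G\<^esub> f) ` ?N \<subseteq> ?S <#>\<^bsub>G\<^esub> F" by auto
    qed
    finally show ?thesis using s(2) by (simp add: algebra_simps)
  qed simp
  obtain n where n: "2 < (1 + \<delta>) ^ n" using real_arch_pow[of "1 + \<delta>" 2] d by auto
  obtain T where T: "finite T" "T \<subseteq> carrier G"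
    "\<And>F. finite F \<Longrightarrow> F \<subseteq> carrier G \<Longrightarrow> (1 + \<delta>) ^ n * real (card F) \<le> real (card (T <#>\<^bsub>G\<^esub> F))"
    using iterated_expansion[of ?S \<delta> n] S d exp by auto
  obtain F where F: "finite F" "F \<subseteq> carrier G" "card (T <#>\<^bsub>G\<^esub> F) < 2 * card F"
    using amenable_group_not_doubling[OF am T(1,2)] by blast
  have "2 * real (card F) \<le> (1 + \<delta>) ^ n * real (card F)" using n by (intro mult_right_mono) auto
  then show False using T(3)[OF F(1,2)] F(3) by linarith
qed

section \<open>Actions of a monoid from actions of its units\<close>

text \<open>
  Soficity quantifies over finite sets of natural numbers only; transport along a bijection allows
  approximations to be built on more convenient types.
\<close>

lemma approx_action_transfer:
  assumes f: "bij_betw f X Y" and act: "approx_action M K \<epsilon> X act" and K: "K \<subseteq> carrier M"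
    and mult: "\<And>g h. g \<in> K \<Longrightarrow> h \<in> K \<Longrightarrow> g \<otimes>\<^bsub>M\<^esub> h \<in> carrier M"
  shows "approx_action M K \<epsilon> Y (\<lambda>m y. f (act m (inv_into X f y)))"
proof -
  note D = approx_actionD[OF act]
  define k where "k = inv_into X f"
  have Y: "Y = f ` X" and inj: "inj_on f X" using f by (auto simp: bij_betw_def)
  have k: "k (f x) = x" if "x \<in> X" for x
    using that inj by (simp add: k_def)
  have card_Y: "card {y \<in> Y. Q y} = card {x \<in> X. Q (f x)}" for Q
  proof -
    have "{y \<in> Y. Q y} = f ` {x \<in> X. Q (f x)}" by (auto simp: Y)
    then show ?thesis using inj by (simp add: card_image inj_on_def)
  qed
  have feq: "f x = f y \<longleftrightarrow> x = y" if "x \<in> X" "y \<in> X" for x y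
    using that inj by (auto simp: inj_on_def)
  have "card Y = card X" using f by (simp add: bij_betw_same_card)
  show ?thesis unfolding k_def[symmetric]
  proof (rule approx_actionI)
    show "finite Y" "Y \<noteq> {}" using D(1,2) by (auto simp: Y)
    show "f (act m (k y)) \<in> Y" if "m \<in> carrier M" "y \<in> Y" for m y
      using that D(3) by (auto simp: Y k)
    show "f (act \<one>\<^bsub>M\<^esub> (k y)) = y" if "y \<in> Y" for y
      using that D(4) by (auto simp: Y k)
  next
    fix g h assume gh: "g \<in> K" "h \<in> K"
    then have c: "g \<in> carrier M" "h \<in> carrier M" "g \<otimes>\<^bsub>M\<^esub> h \<in> carrier M" using K mult by auto
    have "{x \<in> X. f (act g (k (f (act h (k (f x)))))) \<noteq> f (act (g \<otimes>\<^bsub>M\<^esub> h) (k (f x)))}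
        = {x \<in> X. act g (act h x) \<noteq> act (g \<otimes>\<^bsub>M\<^esub> h) x}"
      using c D(3) by (auto simp: k feq)
    then show "real (card {y \<in> Y. f (act g (k (f (act h (k y))))) \<noteq> f (act (g \<otimes>\<^bsub>M\<^esub> h) (k y))})
        \<le> \<epsilon> * real (card Y)"
      using D(5)[OF gh] \<open>card Y = card X\<close> by (simp only: card_Y)
  next
    fix g h assume gh: "g \<in> K" "h \<in> K" "g \<noteq> h"
    then have c: "g \<in> carrier M" "h \<in> carrier M" using K by auto
    have "{x \<in> X. f (act g (k (f x))) = f (act h (k (f x)))} = {x \<in> X. act g x = act h x}"
      using c D(3) by (auto simp: k feq)
    then show "real (card {y \<in> Y. f (act g (k y)) = f (act h (k y))}) \<le> \<epsilon> * real (card Y)"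
      using D(6)[OF gh] \<open>card Y = card X\<close> by (simp only: card_Y)
  qed
qed

lemma sofic_monoidI:
  assumes "monoid M"
    and "\<And>K \<epsilon>. finite K \<Longrightarrow> K \<subseteq> carrier M \<Longrightarrow> 0 < \<epsilon> \<Longrightarrow>
      \<exists>(X :: 'x set) act. approx_action M K \<epsilon> X act"
  shows "sofic_monoid M"
  unfolding sofic_monoid_def
proof (intro conjI allI impI)
  interpret monoid M by fact
  fix K and \<epsilon> :: real assume K: "finite K" "K \<subseteq> carrier M" "0 < \<epsilon>"
  then obtain X :: "'x set" and act where act: "approx_action M K \<epsilon> X act" using assms(2) by blast
  then obtain f :: "'x \<Rightarrow> nat" where "bij_betw f X {0..<card X}"
    using ex_bij_betw_finite_nat[OF approx_actionD(1)[OF act]] by blast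
  then show "\<exists>(Y :: nat set) act. approx_action M K \<epsilon> Y act"
    using approx_action_transfer[OF _ act K(2)] K(2) m_closed subsetD by meson
qed fact

lemma (in monoid) units_approx_actionI:
  fixes \<epsilon> :: real
  assumes "finite X" "X \<noteq> {}"
    and "\<And>m x. m \<in> Units G \<Longrightarrow> x \<in> X \<Longrightarrow> act m x \<in> X"
    and "\<And>x. x \<in> X \<Longrightarrow> act \<one> x = x"
    and "\<And>g h. g \<in> K \<Longrightarrow> h \<in> K \<Longrightarrow>
      real (card {x \<in> X. act g (act h x) \<noteq> act (g \<otimes> h) x}) \<le> \<epsilon> * real (card X)"
    and "\<And>g h. g \<in> K \<Longrightarrow> h \<in> K \<Longrightarrow> g \<noteq> h \<Longrightarrow>
      real (card {x \<in> X. act g x = act h x}) \<le> \<epsilon> * real (card X)"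
  shows "approx_action (G\<lparr>carrier := Units G\<rparr>) K \<epsilon> X act"
  using assms by (intro approx_actionI) simp_all

lemma (in monoid) Units_right_cancel:
  assumes "x \<otimes> u = y \<otimes> u" "u \<in> Units G" "x \<in> carrier G" "y \<in> carrier G"
  shows "x = y"
proof -
  have "x = x \<otimes> u \<otimes> inv u" "y = y \<otimes> u \<otimes> inv u"
    using assms(2-) by (simp_all add: m_assoc Units_closed)
  then show ?thesis using assms(1) by simp
qed

locale monoid_nonunits_ideal = monoid M for M (structure) +
  assumes factor_unit:
    "x \<in> carrier M \<Longrightarrow> y \<in> carrier M \<Longrightarrow> x \<otimes> y \<in> Units M \<Longrightarrow> x \<in> Units M \<and> y \<in> Units M"
begin

text \<open>
  The hypothesis on \<open>\<phi>\<close> is what the relation \<open>m \<sqdot> (h \<sqdot> x) = (m \<otimes> h) \<sqdot> x\<close> says for a non-unit \<open>m\<close> and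
  a unit \<open>h\<close>. The error \<open>\<epsilon>\<close> is shared evenly between the bad points of \<open>X\<close> and the whole of \<open>Y\<close>.
\<close>

lemma approx_action_extend:
  fixes \<epsilon> :: real and \<alpha> :: "'a \<Rightarrow> 'x \<Rightarrow> 'x"
  assumes K: "finite K" "K \<subseteq> carrier M" and e: "0 < \<epsilon>"
    and act: "approx_action (M\<lparr>carrier := Units M\<rparr>) (K \<inter> Units M) (\<epsilon> / 2) X \<alpha>"
    and \<phi>: "\<And>x. x \<in> X \<Longrightarrow> \<phi> x \<in> Units M"
    and equiv: "\<And>m h. m \<in> K - Units M \<Longrightarrow> h \<in> K \<inter> Units M \<Longrightarrow>
      real (card {x \<in> X. m \<otimes> \<phi> (\<alpha> h x) \<noteq> m \<otimes> h \<otimes> \<phi> x}) \<le> \<epsilon> / 2 * real (card X)"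
  shows "\<exists>(Z :: ('x \<times> nat + 'a) set) act. approx_action M K \<epsilon> Z act"
proof -
  note D = approx_actionD[OF act, simplified]
  \<comment> \<open>The products of two elements of \<open>K\<close> are needed as well: \<open>Y\<close> must receive the image of \<open>x\<close> under
    \<open>g \<otimes> h\<close>.\<close>
  define Y where "Y = (\<lambda>(m, x). m \<otimes> \<phi> x) ` ((K \<union> (K <#> K)) \<times> X)"
  have "finite (K <#> K)" using K(1) by (auto simp: set_mult_def)
  then have finY: "finite Y" using K(1) D(1) by (simp add: Y_def)
  have YK: "m \<otimes> \<phi> x \<in> Y" if "m \<in> K" "x \<in> X" for m x
    using that unfolding Y_def by force
  have YKK: "g \<otimes> h \<otimes> \<phi> x \<in> Y" if "g \<in> K" "h \<in> K" "x \<in> X" for g h x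
    using that unfolding Y_def set_mult_def by force
  have \<phi>_carrier: "\<phi> x \<in> carrier M" if "x \<in> X" for x
    using \<phi>[OF that] by (rule Units_closed)
  have Y_carrier: "Y \<subseteq> carrier M"
    using K(2) \<phi>_carrier set_mult_closed[OF K(2) K(2)] unfolding Y_def by auto
  \<comment> \<open>\<open>N\<close> is the number of copies of \<open>X\<close>, taken so large that \<open>Y\<close> is negligible.\<close>
  obtain N where N: "real (card Y) / (\<epsilon> / 2 * real (card X)) \<le> real N"
    using real_arch_simple by blast
  then have N: "real (card Y) \<le> \<epsilon> / 2 * real (card X * N)"
    using e D(2) by (simp add: pos_divide_le_eq mult_ac)
  obtain N where N: "0 < N" "real (card Y) \<le> \<epsilon> / 2 * real (card X * N)"
  proof (rule that[of "Suc N"])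
    have "\<epsilon> / 2 * real (card X * N) \<le> \<epsilon> / 2 * real (card X * Suc N)"
      using e by (intro mult_left_mono) auto
    then show "real (card Y) \<le> \<epsilon> / 2 * real (card X * Suc N)" using N by linarith
  qed simp
  define Z where "Z = (X \<times> {..<N}) <+> Y"
  \<comment> \<open>Products that fall outside \<open>Y\<close> occur only at points of \<open>Y\<close>, which are negligible, or
    for \<open>m\<close> that is neither in \<open>K\<close> nor a product of two elements of \<open>K\<close>; there the point is left
    where it is.\<close>
  define act where "act m z = (case z of
      Inl (x, n) \<Rightarrow> if m \<in> Units M then Inl (\<alpha> m x, n)
        else if m \<otimes> \<phi> x \<in> Y then Inr (m \<otimes> \<phi> x) else Inl (x, n)
    | Inr y \<Rightarrow> Inr (if m \<otimes> y \<in> Y then m \<otimes> y else y))" for m and z :: "'x \<times> nat + 'a"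
  have cardZ: "card Z = card X * N + card Y"
    using D(1) finY by (simp add: Z_def card_Plus card_cartesian_product)
  have small: "real (card S) \<le> \<epsilon> * real (card Z)"
    if S: "S \<subseteq> (B \<times> {..<N}) <+> Y" and B: "finite B" "real (card B) \<le> \<epsilon> / 2 * real (card X)" for S B
  proof -
    have "card S \<le> card ((B \<times> {..<N}) <+> Y)" using S B finY by (intro card_mono) auto
    also have "\<dots> = card B * N + card Y"
      using B finY by (simp add: card_Plus card_cartesian_product)
    finally have "real (card S) \<le> real (card B) * real N + real (card Y)"
      by (metis of_nat_add of_nat_le_iff of_nat_mult)
    also have "real (card B) * real N \<le> \<epsilon> / 2 * real (card X) * real N"
      using B by (intro mult_right_mono) auto
    also have "\<epsilon> / 2 * real (card X) * real N + real (card Y) \<le> \<epsilon> * real (card X * N)"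
      using N(2) by simp
    also have "\<dots> \<le> \<epsilon> * real (card Z)" using e cardZ by (intro mult_left_mono) auto
    finally show ?thesis by simp
  qed
  have none: "real (card ({} :: 'x set)) \<le> \<epsilon> / 2 * real (card X)" using e by simp
  have "approx_action M K \<epsilon> Z act"
  proof (rule approx_actionI)
    show "finite Z" using D(1) finY by (simp add: Z_def)
    show "Z \<noteq> {}" using D(2) N(1) cardZ by auto
    show "act m z \<in> Z" if "m \<in> carrier M" "z \<in> Z" for m z
      using that D(3) by (auto simp: Z_def act_def)
    show "act \<one> z = z" if "z \<in> Z" for z
      using that D(4) Y_carrier by (auto simp: Z_def act_def)
  next
    fix g h assume gh: "g \<in> K" "h \<in> K"
    then have c: "g \<in> carrier M" "h \<in> carrier M" using K by auto
    let ?S = "{z \<in> Z. act g (act h z) \<noteq> act (g \<otimes> h) z}"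
    show "real (card ?S) \<le> \<epsilon> * real (card Z)"
    proof (cases "h \<in> Units M")
      case h: True
      show ?thesis
      proof (cases "g \<in> Units M")
        case g: True
        let ?B = "{x \<in> X. \<alpha> g (\<alpha> h x) \<noteq> \<alpha> (g \<otimes> h) x}"
        have "g \<otimes> h \<in> Units M" using g h by simp
        then have "?S \<subseteq> (?B \<times> {..<N}) <+> Y"
          using g h by (auto simp: Z_def act_def)
        then show ?thesis using D(1) D(5)[of g h] gh g h by (intro small[of _ ?B]) auto
      next
        case g: False
        let ?B = "{x \<in> X. g \<otimes> \<phi> (\<alpha> h x) \<noteq> g \<otimes> h \<otimes> \<phi> x}"
        have "g \<otimes> h \<notin> Units M" using factor_unit[OF c] g by blast
        then have "?S \<subseteq> (?B \<times> {..<N}) <+> Y"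
          using g h gh D(3)[OF h] YK YKK by (auto simp: Z_def act_def)
        then show ?thesis using D(1) equiv[of g h] gh g h by (intro small[of _ ?B]) auto
      qed
    next
      case h: False
      have "g \<otimes> h \<notin> Units M" using factor_unit[OF c] h by blast
      moreover have "g \<otimes> (h \<otimes> \<phi> x) = g \<otimes> h \<otimes> \<phi> x" if "x \<in> X" for x
        using c \<phi>_carrier[OF that] by (simp add: m_assoc)
      ultimately have "?S \<subseteq> ({} \<times> {..<N}) <+> Y"
        using h gh YK YKK by (auto simp: Z_def act_def)
      then show ?thesis using none by (intro small[of _ "{}"]) auto
    qed
  next
    fix g h assume gh: "g \<in> K" "h \<in> K" "g \<noteq> h"
    then have c: "g \<in> carrier M" "h \<in> carrier M" using K by auto
    let ?S = "{z \<in> Z. act g z = act h z}"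
    show "real (card ?S) \<le> \<epsilon> * real (card Z)"
    proof (cases "g \<in> Units M \<and> h \<in> Units M")
      case True
      let ?B = "{x \<in> X. \<alpha> g x = \<alpha> h x}"
      have "?S \<subseteq> (?B \<times> {..<N}) <+> Y" using True by (auto simp: Z_def act_def)
      then show ?thesis using D(1) D(6)[of g h] gh True by (intro small[of _ ?B]) auto
    next
      case False
      have "g \<otimes> \<phi> x \<noteq> h \<otimes> \<phi> x" if "x \<in> X" for x
        using Units_right_cancel \<phi>[OF that] c gh(3) by blast
      then have "?S \<subseteq> ({} \<times> {..<N}) <+> Y"
        using False gh YK by (auto simp: Z_def act_def split: if_splits)
      then show ?thesis using none by (intro small[of _ "{}"]) auto
    qed
  qed
  then show ?thesis by blast
qed

text \<open>
  Left multiplication on a Folner set \<open>F\<close> of units, repaired to fix the points that would leave \<open>F\<close>,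
  is an approximate action, and the inclusion of \<open>F\<close> into the units is equivariant at all points that
  stay in \<open>F\<close>. A point can be bad for the product \<open>g \<otimes> h\<close> in two ways, by leaving \<open>F\<close> under \<open>h\<close> or
  under \<open>g \<otimes> h\<close>, so \<open>F\<close> is taken invariant up to \<open>\<epsilon> / 4\<close> under products as well.
\<close>

lemma sofic_of_amenable_units:
  assumes "amenable_group (M\<lparr>carrier := Units M\<rparr>)"
  shows "sofic_monoid M"
proof (rule sofic_monoidI)
  fix K and \<epsilon> :: real assume K: "finite K" "K \<subseteq> carrier M" and e: "0 < \<epsilon>"
  define S where "S = (K \<union> (K <#> K)) \<inter> Units M"
  have S: "finite S" "S \<subseteq> Units M" using K(1) by (auto simp: S_def set_mult_def)
  have "\<exists>F. finite F \<and> F \<noteq> {} \<and> F \<subseteq> Units M \<and>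
      (\<forall>s\<in>S. real (card {f \<in> F. s \<otimes> f \<notin> F}) \<le> \<epsilon> / 4 * real (card F))"
    using amenable_group_Folner[OF assms, of S "\<epsilon> / 4"] S e by simp
  then obtain F where F: "finite F" "F \<noteq> {}" "F \<subseteq> Units M"
    and Folner: "\<And>s. s \<in> S \<Longrightarrow> real (card {f \<in> F. s \<otimes> f \<notin> F}) \<le> \<epsilon> / 4 * real (card F)"
    by blast
  have e': "0 \<le> \<epsilon> / 4 * real (card F)" using e by simp
  have SK: "s \<in> S" if "s \<in> K \<inter> Units M" for s using that by (auto simp: S_def)
  have SKK: "g \<otimes> h \<in> S" if "g \<in> K \<inter> Units M" "h \<in> K \<inter> Units M" for g h
    using that by (auto simp: S_def set_mult_def)
  define \<alpha> where "\<alpha> g f = (if g \<otimes> f \<in> F then g \<otimes> f else f)" for g f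
  have "\<exists>(Z :: ('a \<times> nat + 'a) set) act. approx_action M K \<epsilon> Z act"
  proof (rule approx_action_extend[OF K e, where X = F and \<alpha> = \<alpha> and \<phi> = id])
    show "approx_action (M\<lparr>carrier := Units M\<rparr>) (K \<inter> Units M) (\<epsilon> / 2) F \<alpha>"
    proof (rule units_approx_actionI[OF F(1,2)])
      show "\<alpha> m x \<in> F" if "x \<in> F" for m x using that by (simp add: \<alpha>_def)
      show "\<alpha> \<one> x = x" if "x \<in> F" for x using that F(3) by (simp add: \<alpha>_def subset_iff Units_closed)
    next
      fix g h assume gh: "g \<in> K \<inter> Units M" "h \<in> K \<inter> Units M"
      let ?B = "{f \<in> F. h \<otimes> f \<notin> F}" and ?B' = "{f \<in> F. g \<otimes> h \<otimes> f \<notin> F}"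
      have "g \<otimes> (h \<otimes> f) = g \<otimes> h \<otimes> f" if "f \<in> F" for f
        using gh that F(3) K by (intro m_assoc[symmetric]) (auto intro: Units_closed)
      then have sub: "{f \<in> F. \<alpha> g (\<alpha> h f) \<noteq> \<alpha> (g \<otimes> h) f} \<subseteq> ?B \<union> ?B'"
        by (auto simp: \<alpha>_def)
      have "real (card (?B \<union> ?B')) \<le> \<epsilon> / 2 * real (card F)"
        using card_Un_real[of ?B ?B'] Folner[OF SK[OF gh(2)]] Folner[OF SKK[OF gh]] by simp
      then show "real (card {f \<in> F. \<alpha> g (\<alpha> h f) \<noteq> \<alpha> (g \<otimes> h) f}) \<le> \<epsilon> / 2 * real (card F)"
        using F(1) by (intro card_sub_le[OF _ sub]) auto
    next
      fix g h assume gh: "g \<in> K \<inter> Units M" "h \<in> K \<inter> Units M" "g \<noteq> h"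
      let ?B = "{f \<in> F. g \<otimes> f \<notin> F}" and ?B' = "{f \<in> F. h \<otimes> f \<notin> F}"
      have "g \<otimes> f \<noteq> h \<otimes> f" if "f \<in> F" for f
        using Units_right_cancel[of g f h] that F(3) gh K(2) by blast
      then have sub: "{f \<in> F. \<alpha> g f = \<alpha> h f} \<subseteq> ?B \<union> ?B'"
        by (auto simp: \<alpha>_def)
      have "real (card (?B \<union> ?B')) \<le> \<epsilon> / 2 * real (card F)"
        using card_Un_real[of ?B ?B'] Folner[OF SK[OF gh(1)]] Folner[OF SK[OF gh(2)]] by simp
      then show "real (card {f \<in> F. \<alpha> g f = \<alpha> h f}) \<le> \<epsilon> / 2 * real (card F)"
        using F(1) by (intro card_sub_le[OF _ sub]) auto
    qed
  next
    show "id x \<in> Units M" if "x \<in> F" for x using that F(3) by auto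
  next
    fix m h assume mh: "m \<in> K - Units M" "h \<in> K \<inter> Units M"
    have "m \<otimes> (h \<otimes> f) = m \<otimes> h \<otimes> f" if "f \<in> F" for f
      using mh that F(3) K by (intro m_assoc[symmetric]) (auto intro: Units_closed)
    then have sub: "{x \<in> F. m \<otimes> id (\<alpha> h x) \<noteq> m \<otimes> h \<otimes> id x} \<subseteq> {f \<in> F. h \<otimes> f \<notin> F}"
      by (auto simp: \<alpha>_def)
    show "real (card {x \<in> F. m \<otimes> id (\<alpha> h x) \<noteq> m \<otimes> h \<otimes> id x}) \<le> \<epsilon> / 2 * real (card F)"
      using F(1) Folner[OF SK[OF mh(2)]] e' by (intro card_sub_le[OF _ sub]) auto
  qed
  then show "\<exists>(Z :: ('a \<times> nat + 'a) set) act. approx_action M K \<epsilon> Z act" .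
qed (rule monoid_axioms)

text \<open>
  The finite set \<open>P\<close> consists of the right multiplications by units, restricted to the union \<open>L\<close> of
  the orbits of the non-units in \<open>K\<close>. The units act on \<open>P\<close> from the left by an honest action \<open>\<sigma>\<close>, for
  which \<open>u \<mapsto> \<rho> u\<close> is equivariant. A section \<open>\<kappa>\<close> of \<open>\<rho>\<close> need not be equivariant, but it is so after
  multiplication by an element of \<open>L\<close> on the left, since \<open>m \<otimes> \<kappa> p = p m\<close>. The action on \<open>P\<close> is far
  from free in general; the sofic approximation in the other factor separates different units.
\<close>

lemma sofic_of_finite_orbits:
  assumes sofic: "sofic_group (M\<lparr>carrier := Units M\<rparr>)"
    and orbits: "\<And>m. m \<in> carrier M - Units M \<Longrightarrow> finite (m <# Units M)"
  shows "sofic_monoid M"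
proof (rule sofic_monoidI)
  fix K and \<epsilon> :: real assume K: "finite K" "K \<subseteq> carrier M" and e: "0 < \<epsilon>"
  let ?U = "M\<lparr>carrier := Units M\<rparr>"
  have "\<exists>(X :: nat set) \<beta>. approx_action ?U (K \<inter> Units M) (\<epsilon> / 2) X \<beta>"
    using sofic_group_imp_sofic_monoid[OF sofic] K(1) e by (simp add: sofic_monoid_def)
  then obtain X :: "nat set" and \<beta> where act: "approx_action ?U (K \<inter> Units M) (\<epsilon> / 2) X \<beta>" by blast
  note D = approx_actionD[OF act, simplified]
  define L where "L = (\<Union>m\<in>K - Units M. m <# Units M)"
  have finL: "finite L" using K orbits by (auto simp: L_def)
  have L_carrier: "L \<subseteq> carrier M" using K(2) by (auto simp: L_def l_coset_def Units_closed)
  have KL: "m \<in> L" if "m \<in> K - Units M" for m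
  proof -
    have "m = m \<otimes> \<one>" using that K(2) by auto
    then show ?thesis using that by (auto simp: L_def l_coset_def)
  qed
  have L_Units: "m \<otimes> u \<in> L" if mu: "m \<in> L" "u \<in> Units M" for m u
  proof -
    obtain k v where kv: "k \<in> K - Units M" "v \<in> Units M" "m = k \<otimes> v"
      using mu(1) by (auto simp: L_def l_coset_def)
    then have "m \<otimes> u = k \<otimes> (v \<otimes> u)" using mu(2) K(2) by (auto simp: m_assoc Units_closed)
    then show ?thesis using kv mu(2) by (auto simp: L_def l_coset_def)
  qed
  define \<rho> where "\<rho> u = (\<lambda>m\<in>L. m \<otimes> u)" for u
  define P where "P = \<rho> ` Units M"
  define \<sigma> where "\<sigma> h p = (\<lambda>m\<in>L. p (m \<otimes> h))" for h and p :: "'a \<Rightarrow> 'a"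
  have "P \<subseteq> L \<rightarrow>\<^sub>E L" using L_Units by (auto simp: P_def \<rho>_def)
  moreover have "finite (L \<rightarrow>\<^sub>E L)" using finL by (simp add: finite_PiE)
  ultimately have finP: "finite P" by (rule finite_subset)
  have P_nonempty: "P \<noteq> {}" using Units_one_closed by (auto simp: P_def)
  have \<sigma>\<rho>: "\<sigma> h (\<rho> u) = \<rho> (h \<otimes> u)" if "h \<in> Units M" "u \<in> Units M" for h u
    using that L_Units L_carrier by (auto simp: \<sigma>_def \<rho>_def fun_eq_iff m_assoc Units_closed subset_iff)
  have \<sigma>P: "\<sigma> h p \<in> P" if "h \<in> Units M" "p \<in> P" for h p
    using that \<sigma>\<rho> by (auto simp: P_def)
  have \<sigma>_one: "\<sigma> \<one> p = p" if "p \<in> P" for p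
    using that \<sigma>\<rho> by (auto simp: P_def Units_closed)
  have \<sigma>_mult: "\<sigma> g (\<sigma> h p) = \<sigma> (g \<otimes> h) p" if "g \<in> Units M" "h \<in> Units M" "p \<in> P" for g h p
    using that \<sigma>\<rho> by (auto simp: P_def Units_closed m_assoc)
  define \<kappa> where "\<kappa> = inv_into (Units M) \<rho>"
  have \<kappa>_Units: "\<kappa> p \<in> Units M" if "p \<in> P" for p
    using that unfolding \<kappa>_def P_def by (rule inv_into_into)
  have \<kappa>: "m \<otimes> \<kappa> p = p m" if "m \<in> L" "p \<in> P" for m p
  proof -
    have "p = \<rho> (\<kappa> p)" using that(2) by (simp add: \<kappa>_def P_def f_inv_into_f)
    then show ?thesis using that(1) by (metis \<rho>_def restrict_apply')
  qed
  define \<alpha> where "\<alpha> h z = (\<beta> h (fst z), \<sigma> h (snd z))" for h z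
  have fibred: "real (card S) \<le> \<epsilon> / 2 * real (card (X \<times> P))"
    if S: "S \<subseteq> B \<times> P" and B: "B \<subseteq> X" "real (card B) \<le> \<epsilon> / 2 * real (card X)" for S B
  proof -
    have "finite (B \<times> P)" using B(1) D(1) finP finite_subset by blast
    then have "real (card S) \<le> real (card B) * real (card P)"
      using card_mono[OF _ S] by (metis card_cartesian_product of_nat_le_iff of_nat_mult)
    also have "\<dots> \<le> \<epsilon> / 2 * real (card X) * real (card P)"
      using B by (intro mult_right_mono) auto
    finally show ?thesis by (simp add: card_cartesian_product)
  qed
  have "\<exists>(Z :: ((nat \<times> ('a \<Rightarrow> 'a)) \<times> nat + 'a) set) act. approx_action M K \<epsilon> Z act"
  proof (rule approx_action_extend[OF K e, where X = "X \<times> P" and \<alpha> = \<alpha> and \<phi> = "\<kappa> \<circ> snd"])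
    show "approx_action ?U (K \<inter> Units M) (\<epsilon> / 2) (X \<times> P) \<alpha>"
    proof (rule units_approx_actionI)
      show "finite (X \<times> P)" using D(1) finP by simp
      show "X \<times> P \<noteq> {}" using D(2) P_nonempty by auto
      show "\<alpha> m z \<in> X \<times> P" if "m \<in> Units M" "z \<in> X \<times> P" for m z
        using that D(3) \<sigma>P by (auto simp: \<alpha>_def)
      show "\<alpha> \<one> z = z" if "z \<in> X \<times> P" for z
        using that D(4) \<sigma>_one by (auto simp: \<alpha>_def)
    next
      fix g h assume gh: "g \<in> K \<inter> Units M" "h \<in> K \<inter> Units M"
      let ?B = "{x \<in> X. \<beta> g (\<beta> h x) \<noteq> \<beta> (g \<otimes> h) x}"
      have "{z \<in> X \<times> P. \<alpha> g (\<alpha> h z) \<noteq> \<alpha> (g \<otimes> h) z} \<subseteq> ?B \<times> P"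
        using gh \<sigma>_mult by (auto simp: \<alpha>_def)
      then show "real (card {z \<in> X \<times> P. \<alpha> g (\<alpha> h z) \<noteq> \<alpha> (g \<otimes> h) z})
          \<le> \<epsilon> / 2 * real (card (X \<times> P))"
        by (rule fibred) (use D(5)[of g h] gh in auto)
    next
      fix g h assume gh: "g \<in> K \<inter> Units M" "h \<in> K \<inter> Units M" "g \<noteq> h"
      have "{z \<in> X \<times> P. \<alpha> g z = \<alpha> h z} \<subseteq> {x \<in> X. \<beta> g x = \<beta> h x} \<times> P"
        by (auto simp: \<alpha>_def)
      then show "real (card {z \<in> X \<times> P. \<alpha> g z = \<alpha> h z}) \<le> \<epsilon> / 2 * real (card (X \<times> P))"
        by (rule fibred) (use D(6)[of g h] gh in auto)
    qed
  next
    show "(\<kappa> \<circ> snd) z \<in> Units M" if "z \<in> X \<times> P" for z using that \<kappa>_Units by auto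
  next
    fix m h assume mh: "m \<in> K - Units M" "h \<in> K \<inter> Units M"
    have "m \<otimes> \<kappa> (\<sigma> h p) = m \<otimes> h \<otimes> \<kappa> p" if p: "p \<in> P" for p
    proof -
      have "m \<otimes> \<kappa> (\<sigma> h p) = \<sigma> h p m" using KL[OF mh(1)] \<sigma>P mh(2) p by (intro \<kappa>) auto
      also have "\<dots> = p (m \<otimes> h)" using KL[OF mh(1)] by (simp add: \<sigma>_def)
      also have "\<dots> = m \<otimes> h \<otimes> \<kappa> p" using L_Units[OF KL[OF mh(1)]] mh(2) p by (intro \<kappa>[symmetric]) auto
      finally show ?thesis .
    qed
    then have none: "{z \<in> X \<times> P. m \<otimes> (\<kappa> \<circ> snd) (\<alpha> h z) \<noteq> m \<otimes> h \<otimes> (\<kappa> \<circ> snd) z} = {}"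
      by (auto simp: \<alpha>_def)
    show "real (card {z \<in> X \<times> P. m \<otimes> (\<kappa> \<circ> snd) (\<alpha> h z) \<noteq> m \<otimes> h \<otimes> (\<kappa> \<circ> snd) z})
        \<le> \<epsilon> / 2 * real (card (X \<times> P))"
      unfolding none using e by simp
  qed
  then show "\<exists>(Z :: ((nat \<times> ('a \<Rightarrow> 'a)) \<times> nat + 'a) set) act. approx_action M K \<epsilon> Z act" .
qed (rule monoid_axioms)

end

section \<open>The \<open>\<J>\<close>-class of the identity\<close>

lemma (in monoid) J_class_one_iff:
  assumes "x \<in> carrier G"
  shows "x \<in> J_class G \<one> \<longleftrightarrow> (\<exists>a\<in>carrier G. \<exists>b\<in>carrier G. a \<otimes> x \<otimes> b = \<one>)"
proof -
  have ideal: "(carrier G #> y) <#> carrier G = {u \<otimes> y \<otimes> v |u v. u \<in> carrier G \<and> v \<in> carrier G}" for y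
    by (auto simp: r_coset_def set_mult_def)
  show ?thesis
  proof
    assume "x \<in> J_class G \<one>"
    then have "(carrier G #> x) <#> carrier G = (carrier G #> \<one>) <#> carrier G"
      by (simp add: J_class_def green_J_def)
    moreover have "\<one> \<otimes> \<one> \<otimes> \<one> \<in> (carrier G #> \<one>) <#> carrier G" unfolding ideal by blast
    ultimately have "\<one> \<in> {u \<otimes> x \<otimes> v |u v. u \<in> carrier G \<and> v \<in> carrier G}"
      by (simp add: ideal)
    then show "\<exists>a\<in>carrier G. \<exists>b\<in>carrier G. a \<otimes> x \<otimes> b = \<one>" by force
  next
    assume "\<exists>a\<in>carrier G. \<exists>b\<in>carrier G. a \<otimes> x \<otimes> b = \<one>"
    then obtain a b where ab: "a \<in> carrier G" "b \<in> carrier G" "a \<otimes> x \<otimes> b = \<one>" by blast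
    have "u \<otimes> \<one> \<otimes> v = (u \<otimes> a) \<otimes> x \<otimes> (b \<otimes> v)" if "u \<in> carrier G" "v \<in> carrier G" for u v
    proof -
      have "(u \<otimes> a) \<otimes> x \<otimes> (b \<otimes> v) = u \<otimes> (a \<otimes> x \<otimes> b) \<otimes> v"
        using that ab(1,2) assms by (simp add: m_assoc)
      then show ?thesis using ab(3) by simp
    qed
    moreover have "u \<otimes> x \<otimes> v = (u \<otimes> x) \<otimes> \<one> \<otimes> v" if "u \<in> carrier G" "v \<in> carrier G" for u v
      using that assms by simp
    ultimately have "(carrier G #> x) <#> carrier G = (carrier G #> \<one>) <#> carrier G"
      unfolding ideal using ab(1,2) assms m_closed by (intro equalityI subsetI) (clarify; blast)+
    then show "x \<in> J_class G \<one>" using assms by (simp add: J_class_def green_J_def)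
  qed
qed

theorem corollary3p2:
  fixes M G :: "('a, 'b) monoid_scheme"
  assumes "monoid M"
    and "G = M\<lparr>carrier := J_class M \<one>\<^bsub>M\<^esub>\<rparr>"
    and "sofic_group G"
    and "amenable_group G \<or>
         finite (carrier M - carrier G) \<or>
         (\<forall>x \<in> carrier M - Units M. finite (R_class M x))"
  shows "sofic_monoid M"
proof -
  interpret monoid M by fact
  interpret G: group G using assms(3) by (simp add: sofic_group_def)
  have J: "J_class M \<one>\<^bsub>M\<^esub> = Units M"
  proof (intro equalityI subsetI)
    fix x assume "x \<in> Units M"
    then have "inv\<^bsub>M\<^esub> x \<otimes>\<^bsub>M\<^esub> x \<otimes>\<^bsub>M\<^esub> \<one>\<^bsub>M\<^esub> = \<one>\<^bsub>M\<^esub>" "x \<in> carrier M" "inv\<^bsub>M\<^esub> x \<in> carrier M"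
      by (auto simp: Units_closed)
    then show "x \<in> J_class M \<one>\<^bsub>M\<^esub>" using J_class_one_iff one_closed by blast
  next
    fix x assume "x \<in> J_class M \<one>\<^bsub>M\<^esub>"
    then have "x \<in> carrier G" using assms(2) by simp
    then have "x \<in> Units G" by (simp add: G.Units_eq)
    then show "x \<in> Units M" using assms(2) by (auto simp: Units_def J_class_def)
  qed
  have G: "G = M\<lparr>carrier := Units M\<rparr>" using assms(2) J by simp
  interpret monoid_nonunits_ideal M
  proof
    fix x y assume xy: "x \<in> carrier M" "y \<in> carrier M" "x \<otimes>\<^bsub>M\<^esub> y \<in> Units M"
    then obtain a b where ab: "a \<in> carrier M" "b \<in> carrier M" "a \<otimes>\<^bsub>M\<^esub> (x \<otimes>\<^bsub>M\<^esub> y) \<otimes>\<^bsub>M\<^esub> b = \<one>\<^bsub>M\<^esub>"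
      using J J_class_one_iff[of "x \<otimes>\<^bsub>M\<^esub> y"] by auto
    have "a \<otimes>\<^bsub>M\<^esub> x \<otimes>\<^bsub>M\<^esub> (y \<otimes>\<^bsub>M\<^esub> b) = \<one>\<^bsub>M\<^esub>" "(a \<otimes>\<^bsub>M\<^esub> x) \<otimes>\<^bsub>M\<^esub> y \<otimes>\<^bsub>M\<^esub> b = \<one>\<^bsub>M\<^esub>"
      using ab xy by (simp_all add: m_assoc)
    then show "x \<in> Units M \<and> y \<in> Units M"
      using J_class_one_iff[OF xy(1)] J_class_one_iff[OF xy(2)] J ab xy m_closed by metis
  qed
  consider "amenable_group G" | "finite (carrier M - Units M)"
    | "\<forall>x\<in>carrier M - Units M. finite (R_class M x)"
    using assms(4) G by auto
  then show ?thesis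
  proof cases
    case 1
    then show ?thesis using sofic_of_amenable_units G by simp
  next
    case 2
    have "finite (m <#\<^bsub>M\<^esub> Units M)" if m: "m \<in> carrier M - Units M" for m
    proof (rule finite_subset[OF _ 2], rule subsetI)
      fix y assume "y \<in> m <#\<^bsub>M\<^esub> Units M"
      then obtain u where u: "u \<in> Units M" "y = m \<otimes>\<^bsub>M\<^esub> u" by (auto simp: l_coset_def)
      then show "y \<in> carrier M - Units M" using factor_unit[of m u] m by auto
    qed
    then show ?thesis
      using sofic_of_finite_orbits assms(3) G by simp
  next
    case 3
    have "m <#\<^bsub>M\<^esub> Units M \<subseteq> R_class M m" if m: "m \<in> carrier M" for m
    proof
      fix y assume "y \<in> m <#\<^bsub>M\<^esub> Units M"
      then obtain u where u: "u \<in> Units M" "y = m \<otimes>\<^bsub>M\<^esub> u" by (auto simp: l_coset_def)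
      have "m \<otimes>\<^bsub>M\<^esub> z = y \<otimes>\<^bsub>M\<^esub> (inv\<^bsub>M\<^esub> u \<otimes>\<^bsub>M\<^esub> z)" if "z \<in> carrier M" for z
      proof -
        have "y \<otimes>\<^bsub>M\<^esub> (inv\<^bsub>M\<^esub> u \<otimes>\<^bsub>M\<^esub> z) = m \<otimes>\<^bsub>M\<^esub> (u \<otimes>\<^bsub>M\<^esub> inv\<^bsub>M\<^esub> u) \<otimes>\<^bsub>M\<^esub> z"
          using that u m by (simp only: m_assoc Units_closed Units_inv_closed m_closed)
        then show ?thesis using u m by simp
      qed
      moreover have "y \<otimes>\<^bsub>M\<^esub> z = m \<otimes>\<^bsub>M\<^esub> (u \<otimes>\<^bsub>M\<^esub> z)" if "z \<in> carrier M" for z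
        using that u m by (simp add: m_assoc Units_closed)
      moreover have "inv\<^bsub>M\<^esub> u \<otimes>\<^bsub>M\<^esub> z \<in> carrier M" "u \<otimes>\<^bsub>M\<^esub> z \<in> carrier M" if "z \<in> carrier M" for z
        using that u by (auto simp: Units_closed)
      ultimately have "y <#\<^bsub>M\<^esub> carrier M = m <#\<^bsub>M\<^esub> carrier M"
        unfolding l_coset_def by (intro equalityI subsetI) (clarify; blast)+
      then show "y \<in> R_class M m" using u m by (auto simp: R_class_def green_R_def Units_closed)
    qed
    then show ?thesis
      using sofic_of_finite_orbits assms(3) G 3 by (meson DiffD1 finite_subset)
  qed
qed

end
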